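(* Let $b\geqslant 2$ be an integer. Then $$\limsup_{m\to\infty}\frac{s_b(m)}{m^{\log_b \varphi}}=\frac{\varphi^{\log_b(b^2-1)}}{\sqrt{5}},$$ where $\varphi=(\sqrt 5+1)/2$ is the golden ratio and $s_b(m)$ is the number of hyper-($b$-ary)-expansions of $m-1$ (for integers $m\geqslant 1$).
   Context: For an integer $b\geqslant 2$ and an integer $n\geqslant 0$, a hyper-($b$-ary)-expansion of $n$ is an expansion $n=\sum_{i\geqslant 0} a_i b^i$ where $a_i\in\{0,1,\ldots,b\}$ for all $i$ and $a_i=0$ for all but finitely many indices $i$. For $n\geqslant 1$, $s_b(n)$ denotes the number of hyper-($b$-ary)-expansions of $n-1$, and $s_b(0)=0$. Equivalently, $s_b(0)=0$, $s_b(1)=1$, and for $n\geqslant 0$: $s_b(bn)=s_b(n)$, $s_b(bn+1)=s_b(n)+s_b(n+1)$, and $s_b(bn+i)=s_b(n+1)$ for $i=2,\ldots,b-1$. Here $\log_b$ is the logarithm to base $b$. *)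

theory Defs
  imports Complex_Main "HOL-Library.Extended_Real"
begin

definition hyper_expansions :: "nat \<Rightarrow> nat \<Rightarrow> (nat \<Rightarrow> nat) set" where
  "hyper_expansions b n =
     {a. (\<forall>i. a i \<le> b) \<and> finite {i. a i \<noteq> 0} \<and> n = (\<Sum>i | a i \<noteq> 0. a i * b ^ i)}"

definition s :: "nat \<Rightarrow> nat \<Rightarrow> nat" where
  "s b n = (if n = 0 then 0 else card (hyper_expansions b (n - 1)))"

definition phi :: real where
  "phi = (sqrt 5 + 1) / 2"

text \<open>The cardinality in the definition of \<open>s\<close> is the true number of expansions, since the set
  is finite for \<open>b \<ge> 2\<close>.\<close>

lemma finite_hyper_expansions:
  assumes "b \<ge> 2"
  shows "finite (hyper_expansions b n)"
proof (rule finite_subset)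
  show "hyper_expansions b n \<subseteq>
      {a. \<forall>i. (i \<in> {..n} \<longrightarrow> a i \<in> {..b}) \<and> (i \<notin> {..n} \<longrightarrow> a i = 0)}"
  proof (intro subsetI CollectI allI conjI impI)
    fix a i assume a: "a \<in> hyper_expansions b n"
    show "a i \<in> {..b}" using a by (simp add: hyper_expansions_def)
  next
    fix a i assume a: "a \<in> hyper_expansions b n"
    assume i: "i \<notin> {..n}"
    show "a i = 0"
    proof (rule ccontr)
      assume nz: "a i \<noteq> 0"
      have "i < b ^ i" using assms by (simp add: power_gt_expt)
      also have "b ^ i \<le> a i * b ^ i" using nz by simp
      also have "\<dots> \<le> (\<Sum>i | a i \<noteq> 0. a i * b ^ i)"
        using a nz member_le_sum[of i "{i. a i \<noteq> 0}" "\<lambda>i. a i * b ^ i"]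
        by (simp add: hyper_expansions_def)
      also have "\<dots> = n" using a by (simp add: hyper_expansions_def)
      finally show False using i by simp
    qed
  qed
  show "finite {a. \<forall>i. (i \<in> {..n} \<longrightarrow> a i \<in> {..b}) \<and> (i \<notin> {..n} \<longrightarrow> a i = (0::nat))}"
    by (rule finite_set_of_finite_funs) auto
qed

end

theory Submission
  imports Defs "HOL-Number_Theory.Fib" "HOL-Analysis.Convex"
begin

text \<open>
  Write \<open>F\<^sub>k\<close> for the Fibonacci numbers, \<open>\<alpha> = log\<^sub>b \<phi>\<close> and \<open>C = (b\<^sup>2 - 1)\<^sup>\<alpha> / sqrt 5\<close>; the number \<open>C\<close> is the
  claimed limit superior, because \<open>\<phi>\<close> to the power \<open>log\<^sub>b (b\<^sup>2 - 1)\<close> is \<open>b\<^sup>2 - 1\<close> to the power \<open>\<alpha>\<close>.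
  Splitting off the lowest digit of an expansion gives \<open>s(b n + 1) = s(n) + s(n + 1)\<close> and
  \<open>s(b n + i) = s(n + 1)\<close> for \<open>2 \<le> i \<le> b\<close> (\<open>s_carry\<close>, \<open>s_forced_digit\<close>); everything else is
  derived from this recurrence.

  The function \<open>s\<close> is large at the points \<open>p\<^sub>2\<^sub>i = 1 + b\<^sup>2 + b\<^sup>4 + \<dots>\<close> (\<open>i\<close> terms) and
  \<open>p\<^sub>2\<^sub>i\<^sub>+\<^sub>1 = b p\<^sub>2\<^sub>i + 1\<close>, where it takes the values \<open>s(p\<^sub>k) = F\<^sub>k\<close> (\<open>k \<ge> 2\<close>). Since \<open>p\<^sub>k\<close> is asymptotic to
  \<open>b\<^sup>k / (b\<^sup>2 - 1)\<close> and \<open>F\<^sub>k\<close> to \<open>\<phi>\<^sup>k / sqrt 5\<close>, these points show that the limit superior is at least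
  \<open>C\<close> (\<open>s_peak_ge\<close>).

  The upper bound rests on the idea that \<open>s\<close> lies below the concave, piecewise linear graph through
  the points \<open>(p\<^sub>k, F\<^sub>k)\<close>, up to bounded errors; equivalently, below each of the lines that carry
  its segments. The two families of points lie in different residue classes,
  \<open>p\<^sub>k \<equiv> 1\<close> and \<open>p\<^sub>k \<equiv> b + 1\<close> modulo \<open>b\<^sup>2\<close>, and no line of the natural slope \<open>F\<^sub>k\<^sub>-\<^sub>1 (b + 1) / b\<^sup>k\<close>
  is tight at both ends of a segment. The remedy is to prove a pair of parallel bounds, the lower
  one only for arguments \<open>\<equiv> b + 1\<close> modulo \<open>b\<^sup>2\<close> (\<open>below_line\<close>). With this refinement the bounds with
  indices \<open>j\<close> and \<open>j + 1\<close> add up exactly to the bound with index \<open>j + 2\<close> in the critical residue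
  classes (\<open>line_split_carry\<close>, \<open>line_split_double_carry\<close>). All other arguments \<open>m\<close> are dominated:
  a smaller argument, or in one case a slightly larger one, has a value of \<open>s\<close> which is at least
  as large (\<open>s_dominated\<close>, \<open>below_line_induct_residues\<close>). An induction over \<open>j\<close> then gives
  \<open>s_below_lines\<close>.

  Finally, let \<open>t = (b\<^sup>2 - 1) m / b\<^sup>k\<close> with \<open>k\<close> chosen such that \<open>1 \<le> t \<le> b\<close>. The line with index
  \<open>k - 1\<close> reads \<open>s(m) \<le> \<phi>\<^sup>k / sqrt 5 (1 + (\<phi> - 1) (t - 1) / (b - 1)) + O(1)\<close>. The expression in
  parentheses is the chord of \<open>t\<^sup>\<alpha>\<close> between \<open>t = 1\<close> and \<open>t = b\<close>, so by concavity
  \<open>s(m) \<le> C m\<^sup>\<alpha> + O(1)\<close> (\<open>s_le_powr\<close>).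
\<close>

section \<open>The digit recurrence\<close>

lemma hyper_expansions_iff:
  assumes "b \<ge> 2"
  shows "a \<in> hyper_expansions b N \<longleftrightarrow>
    a 0 \<le> b \<and> (\<exists>n. N = a 0 + b * n \<and> a \<circ> Suc \<in> hyper_expansions b n)"
proof -
  define T where "T = {i. a i \<noteq> 0}"
  define T' where "T' = {i. a (Suc i) \<noteq> 0}"
  have T: "T \<subseteq> insert 0 (Suc ` T')" "Suc ` T' \<subseteq> T"
  proof -
    show "T \<subseteq> insert 0 (Suc ` T')"
    proof
      fix i assume "i \<in> T"
      then show "i \<in> insert 0 (Suc ` T')" by (cases i) (auto simp: T_def T'_def)
    qed
  qed (auto simp: T_def T'_def)
  have fin: "finite T \<longleftrightarrow> finite T'"
  proof
    assume "finite T"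
    then show "finite T'" using finite_subset[OF T(2)] finite_imageD[of Suc T'] by simp
  next
    assume "finite T'"
    then show "finite T" using finite_subset[OF T(1)] by simp
  qed
  have sum_eq: "(\<Sum>i\<in>T. a i * b ^ i) = a 0 + b * (\<Sum>i\<in>T'. a (Suc i) * b ^ i)" if "finite T'"
  proof -
    have "(\<Sum>i\<in>T. a i * b ^ i) = (\<Sum>i\<in>insert 0 (Suc ` T'). a i * b ^ i)"
      using that T(1) by (intro sum.mono_neutral_left) (auto simp: T_def)
    also have "\<dots> = a 0 + (\<Sum>i\<in>Suc ` T'. a i * b ^ i)"
      using that by (subst sum.insert) auto
    also have "(\<Sum>i\<in>Suc ` T'. a i * b ^ i) = b * (\<Sum>i\<in>T'. a (Suc i) * b ^ i)"
      by (simp add: sum.reindex sum_distrib_left mult_ac)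
    finally show ?thesis .
  qed
  have le: "(\<forall>i. a i \<le> b) \<longleftrightarrow> a 0 \<le> b \<and> (\<forall>i. a (Suc i) \<le> b)"
    by (metis not0_implies_Suc)
  have "a \<in> hyper_expansions b N \<longleftrightarrow>
      (\<forall>i. a i \<le> b) \<and> finite T \<and> N = (\<Sum>i\<in>T. a i * b ^ i)"
    by (simp add: hyper_expansions_def T_def)
  moreover have "a \<circ> Suc \<in> hyper_expansions b n \<longleftrightarrow>
      (\<forall>i. a (Suc i) \<le> b) \<and> finite T' \<and> n = (\<Sum>i\<in>T'. a (Suc i) * b ^ i)" for n
    by (simp add: hyper_expansions_def T'_def)
  ultimately show ?thesis
    using sum_eq fin le by (cases "finite T'") (simp_all, blast)
qed

lemma s_0 [simp]: "s b 0 = 0"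
  by (simp add: s_def)

lemma card_hyper_expansions_fixed_digit:
  "card ((\<lambda>a. case_nat d a) ` A) = card A" for A :: "(nat \<Rightarrow> nat) set"
proof (rule card_image, rule inj_onI)
  fix x y :: "nat \<Rightarrow> nat" assume "case_nat d x = case_nat d y"
  then have "case_nat d x (Suc i) = case_nat d y (Suc i)" for i by simp
  then show "x = y" by auto
qed

lemma hyper_expansions_digit_split:
  assumes "b \<ge> 2"
  shows "hyper_expansions b N =
    (\<Union>(d, n) \<in> {(d, n). d \<le> b \<and> N = d + b * n}. (\<lambda>a. case_nat d a) ` hyper_expansions b n)"
proof (intro set_eqI iffI)
  fix a assume "a \<in> hyper_expansions b N"
  then obtain n where n: "a 0 \<le> b" "N = a 0 + b * n" "a \<circ> Suc \<in> hyper_expansions b n"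
    using hyper_expansions_iff[OF assms] by blast
  have "a = case_nat (a 0) (a \<circ> Suc)" by (auto simp: fun_eq_iff split: nat.split)
  then show "a \<in> (\<Union>(d, n) \<in> {(d, n). d \<le> b \<and> N = d + b * n}.
      (\<lambda>a. case_nat d a) ` hyper_expansions b n)"
    using n by blast
next
  fix a assume "a \<in> (\<Union>(d, n) \<in> {(d, n). d \<le> b \<and> N = d + b * n}.
      (\<lambda>a. case_nat d a) ` hyper_expansions b n)"
  then obtain d n a' where *: "d \<le> b" "N = d + b * n" "a = case_nat d a'"
    "a' \<in> hyper_expansions b n" by auto
  have "a \<circ> Suc = a'" "a 0 = d" using *(3) by (simp_all add: fun_eq_iff)
  with * show "a \<in> hyper_expansions b N"
    using hyper_expansions_iff[OF assms, of a N] by metis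
qed

lemma s_1:
  assumes "b \<ge> 2"
  shows "s b 1 = 1"
proof -
  have "hyper_expansions b 0 = {\<lambda>_. 0}"
    using assms by (auto simp: hyper_expansions_def fun_eq_iff)
  then show ?thesis by (simp add: s_def)
qed

text \<open>The lowest digit of an expansion of \<open>b * n\<close> is \<open>0\<close> or \<open>b\<close>; in the second case, \<open>1\<close> is carried
  from the remaining number.\<close>

lemma s_carry:
  assumes "b \<ge> 2"
  shows "s b (b * n + 1) = s b n + s b (n + 1)"
proof (cases n)
  case 0
  then show ?thesis by simp
next
  case (Suc n')
  have "(d = 0 \<and> k = n) \<or> (d = b \<and> k = n')" if *: "d \<le> b" "b * n = d + b * k" for d k
  proof -
    have "b > 0" using assms by simp
    have "b * k \<le> b * n" using * by simp
    then have "k \<le> n" using \<open>b > 0\<close> nat_mult_le_cancel1 by blast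
    have "b * n \<le> b * Suc k" using * by simp
    then have "n \<le> Suc k" using \<open>b > 0\<close> nat_mult_le_cancel1 by blast
    with \<open>k \<le> n\<close> have "k = n' \<or> k = n" using Suc by linarith
    then show ?thesis using *(2) Suc by auto
  qed
  then have "{(d, k). d \<le> b \<and> b * n = d + b * k} = {(0, n), (b, n')}"
    using Suc by auto
  then have "hyper_expansions b (b * n) =
      (\<lambda>a. case_nat 0 a) ` hyper_expansions b n \<union> (\<lambda>a. case_nat b a) ` hyper_expansions b n'"
    unfolding hyper_expansions_digit_split[OF assms, of "b * n"] by auto
  moreover have "(\<lambda>a. case_nat 0 a) ` X \<inter> (\<lambda>a. case_nat b a) ` Y = {}"
    for X Y :: "(nat \<Rightarrow> nat) set"
  proof -
    have "case_nat 0 x \<noteq> case_nat b y" for x y :: "nat \<Rightarrow> nat"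
      using assms by (metis old.nat.simps(4) not_numeral_le_zero)
    then show ?thesis by auto
  qed
  ultimately have "card (hyper_expansions b (b * n)) =
      card (hyper_expansions b n) + card (hyper_expansions b n')"
    by (simp add: card_Un_disjoint card_hyper_expansions_fixed_digit
        finite_hyper_expansions[OF assms])
  then show ?thesis by (simp add: s_def Suc)
qed

text \<open>The number to be expanded is \<open>b * n + (i - 1)\<close>, whose lowest digit has to be \<open>i - 1\<close> because
  \<open>0 < i - 1 < b\<close>. The case \<open>i = b\<close> covers the multiples of \<open>b\<close>.\<close>

lemma s_forced_digit:
  assumes "b \<ge> 2" "2 \<le> i" "i \<le> b"
  shows "s b (b * n + i) = s b (n + 1)"
proof -
  obtain e where e: "i = Suc e" "1 \<le> e" "e < b" using assms by (cases i) auto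
  have "d = e \<and> k = n" if *: "d \<le> b" "b * n + e = d + b * k" for d k
  proof -
    have "d \<noteq> b"
    proof
      assume "d = b"
      with * have "(b * n + e) mod b = (b + b * k) mod b" by simp
      then show False using e by simp
    qed
    then have "d < b" using * by simp
    then have "(b * n + e) mod b = e" "(d + b * k) mod b = d" using e by simp_all
    with * have "d = e" by simp
    with * show ?thesis using assms by simp
  qed
  then have "{(d, k). d \<le> b \<and> b * n + e = d + b * k} = {(e, n)}"
    using e by auto
  then have "hyper_expansions b (b * n + e) = (\<lambda>a. case_nat e a) ` hyper_expansions b n"
    unfolding hyper_expansions_digit_split[OF assms(1), of "b * n + e"] by auto
  then show ?thesis
    by (simp add: s_def e card_hyper_expansions_fixed_digit)
qed

text \<open>Remainders are taken in \<open>{1..b}\<close>, matching the two rules of the recurrence.\<close>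

lemma base_decomposition:
  assumes "b \<ge> 2" "m \<ge> 1"
  obtains n i where "m = b * n + i" "1 \<le> i" "i \<le> (b::nat)"
proof
  show "m = b * ((m - 1) div b) + ((m - 1) mod b + 1)"
    using assms mult_div_mod_eq[of b "m - 1"] by linarith
  show "(m - 1) mod b + 1 \<le> b" using assms by (simp add: Suc_leI)
qed simp

lemma s_pos:
  assumes "b \<ge> 2" "m \<ge> 1"
  shows "s b m \<ge> 1"
  using assms(2)
proof (induction m rule: less_induct)
  case (less m)
  show ?case
  proof (cases "m = 1")
    case True
    then show ?thesis using s_1[OF assms(1)] by simp
  next
    case False
    obtain n i where m: "m = b * n + i" "1 \<le> i" "i \<le> b"
      using base_decomposition[OF assms(1) less.prems] by blast
    have "2 * n \<le> b * n" using assms by simp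
    then have "n + 1 < m" using m False less.prems by linarith
    then have "s b (n + 1) \<ge> 1" using less.IH by simp
    also have "s b (n + 1) \<le> s b m"
    proof (cases "i = 1")
      case True
      then show ?thesis unfolding m(1) using s_carry[OF assms(1), of n] by simp
    next
      case False
      then show ?thesis unfolding m(1) using m(2,3) s_forced_digit[OF assms(1), of i n] by simp
    qed
    finally show ?thesis .
  qed
qed

section \<open>Bounding lines\<close>

lemma fib_le_two_power: "fib (j + 2) \<le> 2 ^ j"
proof (induction j)
  case (Suc j)
  have "fib (Suc j) \<le> fib (Suc (Suc j))" by (rule fib_mono) simp
  then show ?case using Suc by simp
qed simp

text \<open>The slope of \<open>line b j\<close> is \<open>b + 1\<close> times this number, which is the common factor in all the
  estimates below. As \<open>fib j / b ^ (j + 1)\<close>, it inherits a recurrence from the Fibonacci numbers.\<close>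

definition slope :: "nat \<Rightarrow> nat \<Rightarrow> real" where
  "slope b j = real (fib j) / real b ^ (j + 1)"

text \<open>With \<open>k = j + 1\<close> and the points \<open>p\<^sub>k\<close> from the introduction, the repunit of length \<open>k\<close> equals
  \<open>(b + 1) p\<^sub>k\<close> for even \<open>k\<close> and \<open>(b + 1) p\<^sub>k - b\<close> for odd \<open>k\<close>. Therefore this line has the value \<open>F\<^sub>k\<close> at
  \<open>p\<^sub>k\<close> if \<open>k\<close> is even, and its value at \<open>p\<^sub>k\<close> is \<open>F\<^sub>k\<close> plus \<open>slope b j * b\<close> if \<open>k\<close> is odd.\<close>

definition line :: "nat \<Rightarrow> nat \<Rightarrow> nat \<Rightarrow> real" where
  "line b j m = real (fib (j + 1)) + slope b j * ((real b + 1) * real m - (\<Sum>i\<le>j. real b ^ i))"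

text \<open>The second bound is needed to be sharp at the points \<open>p\<^sub>k\<close> with odd \<open>k\<close>, which are congruent to
  \<open>b + 1\<close> modulo \<open>b\<^sup>2\<close>; the first bound alone does not reproduce itself in the induction.\<close>

definition below_line :: "nat \<Rightarrow> nat \<Rightarrow> nat \<Rightarrow> bool" where
  "below_line b j m \<longleftrightarrow> real (s b m) \<le> line b j m \<and>
     (\<forall>q. m = b\<^sup>2 * q + b + 1 \<longrightarrow> real (s b m) \<le> line b j m - slope b j * real b)"

lemma below_lineD: "below_line b j m \<Longrightarrow> real (s b m) \<le> line b j m"
  by (simp add: below_line_def)

context
  fixes b :: nat
  assumes b2: "b \<ge> 2"
begin

text \<open>For \<open>2 \<le> i \<le> b\<close>, replacing \<open>b n + i\<close> by the smaller number \<open>b n + 1\<close> adds \<open>s(n)\<close> to the value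
  \<open>s(n + 1)\<close>. Doing this to one of the two lowest digits reduces every argument that is not in one
  of the first two cases. Hence an upper bound that increases with \<open>m\<close> has to be checked in two
  residue classes modulo \<open>b\<^sup>2\<close> only.\<close>

lemma s_dominated:
  assumes "m \<ge> 2"
  obtains (Y) q where "m = b\<^sup>2 * q + b + 1"
    | (X) q where "q \<ge> 1" "m = b\<^sup>2 * q + 1"
    | (less) m' where "m' < m" "s b m \<le> s b m'"
proof -
  obtain n i where m: "m = b * n + i" "1 \<le> i" "i \<le> b"
    using base_decomposition[OF b2, of m] assms by auto
  show thesis
  proof (cases "i = 1")
    case False
    then have "s b m \<le> s b (b * n + 1)"
      using m s_forced_digit[OF b2, of i n] s_carry[OF b2, of n] by simp
    then show thesis using less[of "b * n + 1"] m False by simp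
  next
    case True
    then have "n \<ge> 1" using m assms by (cases n) auto
    then obtain q d where n: "n = b * q + d" "1 \<le> d" "d \<le> b"
      using base_decomposition[OF b2, of n] by blast
    consider "d = 1" | "d = b" | "2 \<le> d" "d < b" using n by linarith
    then show thesis
    proof cases
      case 1
      then show thesis using Y[of q] m True n by (simp add: algebra_simps power2_eq_square)
    next
      case 2
      then show thesis using X[of "q + 1"] m True n by (simp add: algebra_simps power2_eq_square)
    next
      case 3
      have "s b m = s b (b * q + d) + s b (b * q + (d + 1))"
        using m True n s_carry[OF b2, of n] by (simp add: add_ac)
      also have "\<dots> = 2 * s b (q + 1)"
        using 3 s_forced_digit[OF b2, of d q] s_forced_digit[OF b2, of "d + 1" q] by simp
      also have "\<dots> \<le> s b (b * q + 1) + s b (b * q + 2)"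
        using s_carry[OF b2, of q] s_forced_digit[OF b2, of 2 q] b2 by simp
      also have "\<dots> = s b (b * (b * q + 1) + 1)"
        using s_carry[OF b2, of "b * q + 1"] by (simp add: add_ac)
      finally have "s b m \<le> s b (b * (b * q + 1) + 1)" .
      moreover have "b * (b * q + 1) < b * (b * q + d)"
        using 3 b2 by (intro mult_strict_left_mono) auto
      ultimately show thesis using less[of "b * (b * q + 1) + 1"] m True n by simp
    qed
  qed
qed


lemma slope_nonneg: "slope b j \<ge> 0"
  by (simp add: slope_def)

lemma slope_recurrence: "real b ^ 2 * slope b (j + 2) = slope b j + real b * slope b (j + 1)"
  using b2 by (simp add: slope_def field_simps power2_eq_square)

lemma repunit_Suc: "(\<Sum>i\<le>Suc j. real b ^ i) = 1 + real b * (\<Sum>i\<le>j. real b ^ i)"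
  by (simp add: sum.atMost_Suc_shift sum_distrib_left del: sum.atMost_Suc)

lemma line_diff: "line b j m - line b j n = slope b j * (real b + 1) * (real m - real n)"
  by (simp add: line_def algebra_simps)

lemma line_mono: "m \<le> n \<Longrightarrow> line b j m \<le> line b j n"
  by (simp add: line_def slope_nonneg mult_left_mono)

text \<open>This matches \<open>s (b\<^sup>2 q + 1) = s q + s (b q + 1)\<close>. For \<open>q \<equiv> 1\<close> modulo \<open>b\<close>, the argument \<open>b q + 1\<close> is
  congruent to \<open>b + 1\<close> modulo \<open>b\<^sup>2\<close>, so that the sharper bound is the one that applies to it.\<close>

lemma line_split_carry:
  "line b (j + 2) (b\<^sup>2 * q + 1) =
   line b j q + (line b (j + 1) (b * q + 1) - slope b (j + 1) * real b)"
proof -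
  define R where "R = (real b + 1) * real q - (\<Sum>i\<le>j. real b ^ i)"
  have "line b (j + 2) (b\<^sup>2 * q + 1) = real (fib (j + 3)) + (real b ^ 2 * slope b (j + 2)) * R"
    using repunit_Suc[of j] repunit_Suc[of "Suc j"]
    by (simp add: line_def R_def algebra_simps power2_eq_square numeral_3_eq_3 del: sum.atMost_Suc fib.simps)
  moreover have "line b (j + 1) (b * q + 1) - slope b (j + 1) * real b =
      real (fib (j + 2)) + slope b (j + 1) * real b * R"
    using repunit_Suc[of j]
    by (simp add: line_def R_def algebra_simps del: sum.atMost_Suc fib.simps)
  moreover have "line b j q = real (fib (j + 1)) + slope b j * R"
    by (simp add: line_def R_def)
  moreover have "fib (j + 3) = fib (j + 1) + fib (j + 2)"
    by (simp add: numeral_3_eq_3)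
  ultimately show ?thesis
    unfolding slope_recurrence by (simp add: algebra_simps del: fib.simps)
qed

text \<open>This matches \<open>s (b\<^sup>2 q + b + 1) = s (b q + 1) + s (q + 1)\<close> with the sharper bound for \<open>q + 1\<close>, which
  applies if \<open>q \<equiv> b\<close> modulo \<open>b\<^sup>2\<close>.\<close>

lemma line_split_double_carry:
  "line b (j + 2) (b\<^sup>2 * q + b + 1) - slope b (j + 2) * real b =
   line b (j + 1) (b * q + 1) + (line b j (q + 1) - slope b j * real b)"
proof -
  define R where "R = (real b + 1) * real q + 1 - (\<Sum>i\<le>j. real b ^ i)"
  have "line b (j + 2) (b\<^sup>2 * q + b + 1) - slope b (j + 2) * real b =
      real (fib (j + 3)) + (real b ^ 2 * slope b (j + 2)) * R"
    using repunit_Suc[of j] repunit_Suc[of "Suc j"]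
    by (simp add: line_def R_def algebra_simps power2_eq_square numeral_3_eq_3 del: sum.atMost_Suc fib.simps)
  moreover have "line b (j + 1) (b * q + 1) =
      real (fib (j + 2)) + slope b (j + 1) * real b * R"
    using repunit_Suc[of j]
    by (simp add: line_def R_def algebra_simps del: sum.atMost_Suc fib.simps)
  moreover have "line b j (q + 1) - slope b j * real b = real (fib (j + 1)) + slope b j * R"
    by (simp add: line_def R_def algebra_simps)
  moreover have "fib (j + 3) = fib (j + 1) + fib (j + 2)"
    by (simp add: numeral_3_eq_3)
  ultimately show ?thesis
    unfolding slope_recurrence by (simp add: algebra_simps del: fib.simps)
qed

lemma repunit_le: "(\<Sum>i\<le>j. real b ^ i) \<le> real b ^ (j + 1)"
proof (induction j)
  case (Suc j)
  have "(\<Sum>i\<le>Suc j. real b ^ i) \<le> 2 * real b ^ (j + 1)" using Suc by simp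
  also have "\<dots> \<le> real b * real b ^ (j + 1)" using b2 by (intro mult_right_mono) auto
  finally show ?case by simp
qed (use b2 in simp)

lemma line_ge: "line b j m \<ge> real (fib (j + 1)) - real (fib j) + slope b j * (real b + 1) * real m"
proof -
  have "slope b j * (\<Sum>i\<le>j. real b ^ i) \<le> slope b j * real b ^ (j + 1)"
    by (intro mult_left_mono repunit_le slope_nonneg)
  also have "\<dots> = real (fib j)" using b2 by (simp add: slope_def)
  finally show ?thesis by (simp add: line_def algebra_simps)
qed

lemma one_le_line:
  assumes "j \<ge> 1" "m \<ge> 1"
  shows "1 \<le> line b j m"
proof (cases "j = 1")
  case True
  have "line b 1 1 = 1" using b2 by (simp add: line_def)
  then show ?thesis using line_mono[of 1 m j] assms True by simp
next
  case False
  then obtain i where i: "j = Suc (Suc i)" using assms by (metis One_nat_def Suc_le_D not0_implies_Suc)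
  have "fib (Suc i) \<ge> 1" using fib_neq_0_nat[of "Suc i"] by simp
  moreover have "slope b j * (real b + 1) * real m \<ge> 0" by (simp add: slope_nonneg)
  ultimately show ?thesis using line_ge[of j m] by (simp add: i)
qed

lemma line_0_nonneg: "0 \<le> line b j 0"
  using line_ge[of j 0] fib_mono[of j "j + 1"] by (simp del: fib.simps)

text \<open>Strong induction over the argument, reduced by \<open>s_dominated\<close> to the two relevant classes.\<close>

lemma below_line_induct:
  assumes "j \<ge> 1"
    and X: "\<And>q. q \<ge> 1 \<Longrightarrow> (\<And>m. m < b\<^sup>2 * q + 1 \<Longrightarrow> below_line b j m) \<Longrightarrow>
      real (s b (b\<^sup>2 * q + 1)) \<le> line b j (b\<^sup>2 * q + 1)"
    and Y: "\<And>q. (\<And>m. m < b\<^sup>2 * q + b + 1 \<Longrightarrow> below_line b j m) \<Longrightarrow>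
      real (s b (b\<^sup>2 * q + b + 1)) \<le> line b j (b\<^sup>2 * q + b + 1) - slope b j * real b"
  shows "below_line b j m"
proof (induction m rule: less_induct)
  case (less m)
  have Y': "real (s b m) \<le> line b j m - slope b j * real b" if "m = b\<^sup>2 * q + b + 1" for q
    using Y[of q] less that by simp
  have "real (s b m) \<le> line b j m"
  proof (cases "m \<ge> 2")
    case False
    then consider "m = 0" | "m = 1" by linarith
    then show ?thesis
      using line_0_nonneg one_le_line[OF assms(1), of 1] s_1[OF b2] by cases auto
  next
    case True
    then show ?thesis
    proof (cases rule: s_dominated)
      case (Y q)
      then show ?thesis using Y' slope_nonneg[of j] by (smt (verit) mult_nonneg_nonneg of_nat_0_le_iff)
    next
      case (X q)
      then show ?thesis using assms(2)[of q] less by simp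
    next
      case (less m')
      then have "real (s b m) \<le> line b j m'"
        using less.IH[of m'] by (simp add: below_line_def)
      then show ?thesis using line_mono[of m' m j] less(1) by simp
    qed
  qed
  with Y' show ?case by (auto simp: below_line_def)
qed


lemma s_times: "s b (b * n) = s b n"
  using s_forced_digit[OF b2, of b "n - 1"] b2 by (cases n) (auto simp: algebra_simps)

lemma s_split_carry: "s b (b\<^sup>2 * q + 1) = s b q + s b (b * q + 1)"
  using s_carry[OF b2, of "b * q"] s_times[of q] by (simp add: power2_eq_square mult.assoc)

lemma s_split_double_carry: "s b (b\<^sup>2 * q + b + 1) = s b (b * q + 1) + s b (q + 1)"
  using s_carry[OF b2, of "b * q + 1"] s_forced_digit[OF b2, of 2 q] b2
  by (simp add: power2_eq_square algebra_simps)

section \<open>All values lie below all lines\<close>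

text \<open>In this first case no residues modulo \<open>b\<close> are needed: unfolding the recurrence twice bounds
  \<open>s\<close> by a sum with total slope \<open>3 A\<close> in \<open>q\<close>, which is less than the available \<open>A b\<^sup>2\<close>.\<close>

lemma below_line_1: "below_line b 1 m"
proof (rule below_line_induct)
  define A where "A = (real b + 1) / real b ^ 2"
  have B: "real b \<ge> 2" using b2 by simp
  have A: "A * real b ^ 2 = real b + 1" "A > 0" using B by (simp_all add: A_def)
  have "A \<le> 1"
  proof -
    have "2 * real b \<le> real b * real b" using B by (intro mult_right_mono) auto
    then have "real b + 1 \<le> real b ^ 2" using B unfolding power2_eq_square by linarith
    then show ?thesis using B by (simp add: A_def)
  qed
  have L: "line b 1 n = 1 + A * (real n - 1)" for n
    using B by (simp add: line_def slope_def A_def field_simps power2_eq_square)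
  have gap: "slope b 1 * real b = 1 / real b" "A * real b = 1 + 1 / real b"
    using B by (simp_all add: slope_def A_def field_simps power2_eq_square)
  {
    fix q :: nat assume q: "q \<ge> 1" and IH: "\<And>m. m < b\<^sup>2 * q + 1 \<Longrightarrow> below_line b 1 m"
    have "1 < b\<^sup>2" using b2 by (intro one_less_power) auto
    then have "1 * q < b\<^sup>2 * q" using q by (intro mult_strict_right_mono) auto
    then have IH': "real (s b q) \<le> line b 1 q" "real (s b (q + 1)) \<le> line b 1 (q + 1)"
      by - (rule below_lineD[OF IH], linarith)+
    have slack: "real b + 1 - 3 * A \<le> (real b + 1 - 3 * A) * real q"
      using q \<open>A \<le> 1\<close> B mult_left_mono[of 1 "real q" "real b + 1 - 3 * A"] by simp
    note IH' slack
  } note * = this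
  fix q :: nat
  {
    assume q: "q \<ge> 1" and IH: "\<And>m. m < b\<^sup>2 * q + 1 \<Longrightarrow> below_line b 1 m"
    have "real (s b (b\<^sup>2 * q + 1)) = 2 * real (s b q) + real (s b (q + 1))"
      unfolding s_split_carry using s_carry[OF b2, of q] by simp
    also have "\<dots> \<le> 3 + A * (3 * real q - 2)"
      using *(1,2)[OF q IH] unfolding L by (simp add: algebra_simps)
    also have "\<dots> \<le> 1 + (A * real b ^ 2) * real q"
      unfolding A(1) using *(3)[OF q IH] \<open>A \<le> 1\<close> B by (simp add: algebra_simps)
    also have "\<dots> = line b 1 (b\<^sup>2 * q + 1)"
      unfolding L by simp
    finally show "real (s b (b\<^sup>2 * q + 1)) \<le> line b 1 (b\<^sup>2 * q + 1)" .
  }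
  assume IH: "\<And>m. m < b\<^sup>2 * q + b + 1 \<Longrightarrow> below_line b 1 m"
  have eq: "real (s b (b\<^sup>2 * q + b + 1)) = real (s b q) + 2 * real (s b (q + 1))"
    unfolding s_split_double_carry using s_carry[OF b2, of q] by simp
  have "line b 1 (b\<^sup>2 * q + b + 1) - slope b 1 * real b = 2 + (A * real b ^ 2) * real q"
    unfolding L gap using gap(2) by (simp add: algebra_simps)
  moreover have "real (s b q) + 2 * real (s b (q + 1)) \<le> 2 + (A * real b ^ 2) * real q"
  proof (cases "q = 0")
    case True
    then show ?thesis using s_1[OF b2] by simp
  next
    case False
    then have q: "q \<ge> 1" by simp
    have IH': "below_line b 1 m" if "m < b\<^sup>2 * q + 1" for m using IH[of m] that by simp
    have "real (s b q) + 2 * real (s b (q + 1)) \<le> 3 + A * (3 * real q - 1)"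
      using *(1,2)[OF q IH'] unfolding L by (simp add: algebra_simps)
    also have "\<dots> \<le> 2 + (A * real b ^ 2) * real q"
      unfolding A(1) using *(3)[OF q IH'] \<open>A \<le> 1\<close> B by (simp add: algebra_simps)
    finally show ?thesis .
  qed
  ultimately show "real (s b (b\<^sup>2 * q + b + 1)) \<le> line b 1 (b\<^sup>2 * q + b + 1) - slope b 1 * real b"
    using eq by simp
qed simp

text \<open>The left-hand side is the amount by which the sharper bound at \<open>m\<close> lies below the line at
  \<open>m + b\<^sup>2 - b\<close>.\<close>

lemma slope_small:
  assumes "j \<ge> 2"
  shows "slope b j * real b ^ 3 \<le> 1"
proof -
  obtain i where i: "j = i + 2" using assms by (metis add.commute le_Suc_ex)
  have "real (fib j) \<le> real (2 ^ i)" using fib_le_two_power[of i] i by (simp only: of_nat_le_iff)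
  also have "\<dots> \<le> real b ^ i" using b2 by (simp add: power_mono)
  finally have "real (fib j) \<le> real b ^ i" .
  moreover have "slope b j * real b ^ 3 = real (fib j) / real b ^ i"
    using b2 by (simp add: slope_def i field_simps power_add power2_eq_square power3_eq_cube del: fib.simps)
  moreover have "real b ^ i > 0" using b2 by simp
  ultimately show ?thesis by (simp only: divide_le_eq_1_pos)
qed

text \<open>This is the sharper bound for \<open>m = b + 1\<close>, where \<open>s\<close> has the value \<open>2\<close>.\<close>

lemma two_le_line:
  assumes "j \<ge> 2"
  shows "2 \<le> line b j (b + 1) - slope b j * real b"
proof -
  have B: "real b \<ge> 2" using b2 by simp
  consider "j = 2" | "j = 3" | "j \<ge> 4" using assms by linarith
  then show ?thesis
  proof cases
    case 1
    have "{..2} = {0, 1, 2::nat}" by auto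
    then have "line b 2 (b + 1) - slope b 2 * real b = 2"
      by (simp add: line_def algebra_simps power2_eq_square numeral_2_eq_2)
    then show ?thesis using 1 by simp
  next
    case 2
    have "{..3} = {0, 1, 2, 3::nat}" by auto
    then have "line b 3 (b + 1) - slope b 3 * real b = 3 - slope b 3 * real b ^ 3"
      by (simp add: line_def algebra_simps power2_eq_square numeral_3_eq_3)
    then show ?thesis using 2 slope_small[of 3] by simp
  next
    case 3
    then obtain i where i: "j = Suc (Suc (Suc (Suc i)))"
      using le_Suc_ex[of 4 j] by (auto simp: eval_nat_numeral)
    have "fib (Suc (Suc i)) \<ge> 1" "fib (Suc i) \<ge> 1" using fib_neq_0_nat[of "Suc i"] by auto
    then have "2 \<le> real (fib (j + 1)) - real (fib j)" by (simp add: i)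
    moreover have "slope b j * real b \<le> slope b j * ((real b + 1) * real (b + 1))"
      using B by (intro mult_left_mono slope_nonneg) (simp add: algebra_simps)
    ultimately show ?thesis using line_ge[of j "b + 1"] by simp
  qed
qed

text \<open>
  A finer reduction by residues. For \<open>m = b\<^sup>2 q + 1\<close>, either \<open>q \<equiv> 1\<close> modulo \<open>b\<close>, or a smaller \<open>q'\<close>
  satisfies \<open>s q \<le> s q'\<close>; the latter leaves room for the weaker of the two bounds. For
  \<open>m = b\<^sup>2 q + b + 1\<close>, put \<open>r = q div b\<close> and compare with \<open>m' = b\<^sup>2 (b r + 1) + 1\<close>, where
  \<open>s m' = 2 s(r) + 3 s(r + 1)\<close>. If \<open>b\<close> does not divide \<open>q\<close>, then \<open>m' < m\<close> and \<open>s m \<le> s m'\<close>. If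
  \<open>q = b r\<close>, then \<open>s m = 3 s(r) + 2 s(r + 1)\<close> and the class of \<open>r\<close> decides: \<open>r \<equiv> 1\<close> is the critical case
  left as a premise; for \<open>r \<equiv> 0\<close> and \<open>r > 0\<close> the point \<open>m'\<close> is larger than \<open>m\<close>, but \<open>s m'\<close> exceeds \<open>s m\<close>
  by at least \<open>1\<close>, which outweighs the increase of the bound; \<open>r = 0\<close> means \<open>m = b + 1\<close>; for all other \<open>r\<close>
  a smaller \<open>r\<close> gives a value that is at least as large.
\<close>

lemma below_line_induct_residues:
  assumes j: "j \<ge> 2"
    and X0: "\<And>q q'. q \<ge> 2 \<Longrightarrow> q' < q \<Longrightarrow> s b q \<le> s b q' \<Longrightarrow> below_line b j (b * q + 1) \<Longrightarrow>
      real (s b (b\<^sup>2 * q + 1)) \<le> line b j (b\<^sup>2 * q + 1)"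
    and X1: "\<And>q r. q = b * r + 1 \<Longrightarrow> below_line b j (b * q + 1) \<Longrightarrow>
      real (s b (b\<^sup>2 * q + 1)) \<le> line b j (b\<^sup>2 * q + 1)"
    and Y1: "\<And>q t. q = b * (b * t + 1) \<Longrightarrow> below_line b j (b * q + 1) \<Longrightarrow>
      real (s b (b\<^sup>2 * q + b + 1)) \<le> line b j (b\<^sup>2 * q + b + 1) - slope b j * real b"
  shows "below_line b j m"
proof (rule below_line_induct)
  have B: "real b \<ge> 2" using b2 by simp
  have sq: "b * n < b\<^sup>2 * n" if "n \<ge> 1" for n
    using that b2 by (simp add: power2_eq_square)
  fix q :: nat
  {
    assume q: "q \<ge> 1" and IH: "\<And>m. m < b\<^sup>2 * q + 1 \<Longrightarrow> below_line b j m"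
    have IH': "below_line b j (b * q + 1)" using IH sq[OF q] by simp
    obtain n i where n: "q = b * n + i" "1 \<le> i" "i \<le> b"
      using base_decomposition[OF b2 q] by blast
    show "real (s b (b\<^sup>2 * q + 1)) \<le> line b j (b\<^sup>2 * q + 1)"
    proof (cases "i = 1")
      case True
      then show ?thesis using X1[of q n, OF _ IH'] n(1) by simp
    next
      case False
      then have "s b q \<le> s b (b * n + 1)"
        using n s_forced_digit[OF b2, of i n] s_carry[OF b2, of n] by simp
      then show ?thesis using X0[of q "b * n + 1"] IH' n False by simp
    qed
  }
  assume IH: "\<And>m. m < b\<^sup>2 * q + b + 1 \<Longrightarrow> below_line b j m"
  define r d where "r = q div b" and "d = q mod b"
  have q: "q = b * r + d" "d < b" using b2 by (simp_all add: r_def d_def)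
  let ?m = "b\<^sup>2 * q + b + 1"
  have s_m: "s b ?m = s b q + 2 * s b (q + 1)"
    unfolding s_split_double_carry using s_carry[OF b2, of q] by simp
  let ?m' = "b\<^sup>2 * (b * r + 1) + 1"
  have s_m': "s b ?m' = 2 * s b r + 3 * s b (r + 1)"
    unfolding s_split_carry
    using s_carry[OF b2, of r] s_carry[OF b2, of "b * r + 1"] s_forced_digit[OF b2, of 2 r] b2
    by simp
  show "real (s b ?m) \<le> line b j ?m - slope b j * real b"
  proof (cases "d = 0")
    case False
    have "s b (q + 1) = s b (r + 1)"
      using s_forced_digit[OF b2, of "d + 1" r] q False by simp
    moreover have "s b q \<le> s b r + s b (r + 1)"
      using s_forced_digit[OF b2, of d r] s_carry[OF b2, of r] q False by (cases "d = 1") auto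
    ultimately have "s b ?m \<le> s b ?m'" using s_m s_m' by simp
    have "b\<^sup>2 * (b * r + 1) \<le> b\<^sup>2 * q" using q False by (intro mult_le_mono2) simp
    then have le: "?m' + b \<le> ?m" by simp
    have "real (s b ?m) \<le> line b j ?m'"
      using \<open>s b ?m \<le> s b ?m'\<close> IH[of ?m'] le b2 unfolding below_line_def by linarith
    moreover have "line b j (?m' + b) \<le> line b j ?m" by (rule line_mono[OF le])
    moreover have "slope b j * real b \<le> line b j (?m' + b) - line b j ?m'"
    proof -
      have "slope b j * real b * 1 \<le> slope b j * real b * (real b + 1)"
        by (intro mult_left_mono) (simp_all add: slope_nonneg)
      then show ?thesis unfolding line_diff by (simp add: algebra_simps)
    qed
    ultimately show ?thesis by linarith
  next
    case True
    with q have q: "q = b * r" by simp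
    have s_m: "s b ?m = 3 * s b r + 2 * s b (r + 1)"
      using s_m q s_times[of r] s_carry[OF b2, of r] by simp
    show ?thesis
    proof (cases "r = 0")
      case True
      then show ?thesis using two_le_line[OF j] s_m q s_1[OF b2] by simp
    next
      case False
      then have "b\<^sup>2 * r < b\<^sup>2 * q" using q b2 by simp
      then have IHr: "below_line b j (b\<^sup>2 * r + b + 1)" using IH by simp
      obtain t e where r: "r = b * t + e" "1 \<le> e" "e \<le> b"
        using base_decomposition[OF b2, of r] False by auto
      consider "e = 1" | "e = b" | "2 \<le> e" "e < b" using r by linarith
      then show ?thesis
      proof cases
        case 1
        have "b * q < b\<^sup>2 * q" using sq[of q] False q b2 by simp
        then have "below_line b j (b * q + 1)" by (intro IH) linarith
        then show ?thesis using Y1[of q t] q r 1 by simp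
      next
        case 2
        \<comment> \<open>Here \<open>?m' > ?m\<close>, but its bound comes from the premise for \<open>q \<equiv> 1\<close>, which needs
          \<open>below_line\<close> at an argument smaller than \<open>?m\<close> only.\<close>
        have "real (s b ?m') \<le> line b j ?m'"
          using X1[of "b * r + 1" r] IHr by (simp add: algebra_simps power2_eq_square)
        moreover have "s b ?m + 1 \<le> s b ?m'"
          using s_m s_m' s_times[of "t + 1"] s_carry[OF b2, of "t + 1"] s_pos[OF b2, of "t + 2"] r 2
          by (simp add: algebra_simps)
        moreover have "line b j ?m' - line b j ?m + slope b j * real b = slope b j * real b ^ 3"
          unfolding line_diff by (simp add: q algebra_simps power2_eq_square power3_eq_cube)
        ultimately show ?thesis using slope_small[OF j] by linarith
      next
        case 3
        let ?r = "b * t + 1"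
        let ?n = "b\<^sup>2 * (b * ?r) + b + 1"
        have "s b r = s b (t + 1)" "s b (r + 1) = s b (t + 1)"
          using s_forced_digit[OF b2, of e t] s_forced_digit[OF b2, of "e + 1" t] 3 r by simp_all
        moreover have "s b ?r = s b t + s b (t + 1)" "s b (?r + 1) = s b (t + 1)"
          using s_carry[OF b2, of t] s_forced_digit[OF b2, of 2 t] b2 by simp_all
        moreover have "s b ?n = 3 * s b ?r + 2 * s b (?r + 1)"
          unfolding s_split_double_carry
          using s_carry[OF b2, of ?r] s_carry[OF b2, of "b * ?r"] s_times[of ?r] by simp
        ultimately have "s b ?m \<le> s b ?n" using s_m by simp
        moreover have lt: "?n < ?m"
        proof -
          have "?r < r" using r 3 by simp
          then have "b * ?r < b * r" by (rule mult_strict_left_mono) (use b2 in simp)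
          then have "b\<^sup>2 * (b * ?r) < b\<^sup>2 * (b * r)"
            by (rule mult_strict_left_mono) (use b2 in simp)
          then show ?thesis unfolding q by linarith
        qed
        have "real (s b ?n) \<le> line b j ?n - slope b j * real b"
          using IH[OF lt] by (simp add: below_line_def)
        moreover have "line b j ?n \<le> line b j ?m" using lt by (intro line_mono) simp
        ultimately show ?thesis by linarith
      qed
    qed
  qed
qed (use j in simp)

text \<open>The general step would use the line with index \<open>0\<close>, which is the constant \<open>1\<close> and no upper bound
  for \<open>s\<close>. Instead \<open>s q\<close> is estimated by the line with index \<open>1\<close>, and \<open>s (b q + 1)\<close> by the line with
  index \<open>2\<close> itself, at a smaller argument. For \<open>b = 2\<close> these estimates leave
  no slack in the critical classes.\<close>

lemma below_line_2: "below_line b 2 m"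
proof (rule below_line_induct_residues)
  define A where "A = (real b + 1) / real b ^ 2"
  have B: "real b \<ge> 2" using b2 by simp
  have A: "A * real b = 1 + 1 / real b" "A > 0"
    using B by (simp_all add: A_def field_simps power2_eq_square)
  have L1: "line b 1 n = 1 + A * (real n - 1)" for n
    using B by (simp add: line_def slope_def A_def field_simps power2_eq_square)
  have "{..2} = {0, 1, 2::nat}" by auto
  then have L2: "line b 2 n = 2 - 1 / real b + A * (real n - 1) / real b" for n
    using B by (simp add: line_def slope_def A_def field_simps power2_eq_square numeral_2_eq_2)
  have gap: "slope b 1 * real b = 1 / real b" "slope b 2 * real b = 1 / real b ^ 2"
    using B by (simp_all add: slope_def field_simps power2_eq_square numeral_2_eq_2)
  have L2_mult: "line b 2 (b * q + 1) = 2 - 1 / real b + A * real q"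
    "line b 2 (b\<^sup>2 * q + 1) = 2 - 1 / real b + A * real b * real q" for q
    using B by (simp_all add: L2 power2_eq_square)
  fix q :: nat
  {
    fix q' assume q': "q \<ge> 2" "q' < q" "s b q \<le> s b q'" "below_line b 2 (b * q + 1)"
    have "line b 1 q' \<le> line b 1 (q - 1)" using q' by (intro line_mono) simp
    also have "\<dots> = 1 + A * (real q - 2)" unfolding L1 using q' by (simp add: of_nat_diff)
    finally have "real (s b q) \<le> 1 + A * (real q - 2)"
      using below_line_1[of q'] q'(3) unfolding below_line_def by linarith
    moreover have "real (s b (b * q + 1)) \<le> 2 - 1 / real b + A * real q"
      using q'(4) L2_mult(1) by (simp add: below_line_def)
    moreover have "1 \<le> A * (2 + (real b - 2) * real q)"
    proof -
      have "1 \<le> A * (2 * real b - 2)"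
      proof -
        have "2 * real b \<le> real b * real b" using B by (intro mult_right_mono) auto
        then have "real b ^ 2 \<le> (real b + 1) * (2 * real b - 2)"
          using B unfolding power2_eq_square ring_distribs by linarith
        then show ?thesis using B by (simp add: A_def pos_le_divide_eq)
      qed
      also have "\<dots> \<le> A * (2 + (real b - 2) * real q)"
        using A(2) B q'(1) mult_left_mono[of 2 "real q" "real b - 2"]
        by (intro mult_left_mono) (auto simp: algebra_simps)
      finally show ?thesis .
    qed
    ultimately show "real (s b (b\<^sup>2 * q + 1)) \<le> line b 2 (b\<^sup>2 * q + 1)"
      unfolding L2_mult s_split_carry by (simp add: algebra_simps)
  }
  {
    fix r assume q: "q = b * r + 1" "below_line b 2 (b * q + 1)"
    have "b * q + 1 = b\<^sup>2 * r + b + 1" by (simp add: q power2_eq_square algebra_simps)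
    then have "real (s b (b * q + 1)) \<le> 2 - 1 / real b + A * real q - 1 / real b ^ 2"
      using q(2) L2_mult(1)[of q] gap(2) unfolding below_line_def by metis
    moreover have "real (s b q) \<le> 1 + A * (real q - 1)"
      using below_lineD[OF below_line_1, of q] unfolding L1 .
    moreover have "1 - 1 / real b ^ 2 \<le> A * (1 + (real b - 2) * real q)"
    proof -
      have "1 - 1 / real b ^ 2 = A * (real b - 1)"
        using B by (simp add: A_def field_simps power2_eq_square)
      also have "\<dots> \<le> A * (1 + (real b - 2) * real q)"
        using A(2) B q(1) mult_left_mono[of 1 "real q" "real b - 2"]
        by (intro mult_left_mono) (auto simp: algebra_simps)
      finally show ?thesis .
    qed
    ultimately show "real (s b (b\<^sup>2 * q + 1)) \<le> line b 2 (b\<^sup>2 * q + 1)"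
      unfolding L2_mult s_split_carry by (simp add: algebra_simps)
  }
  {
    fix t assume q: "q = b * (b * t + 1)" "below_line b 2 (b * q + 1)"
    have "real (s b (b * q + 1)) \<le> 2 - 1 / real b + A * real q"
      using q(2) L2_mult(1) by (simp add: below_line_def)
    moreover have "real (s b (q + 1)) \<le> 1 + A * real q - 1 / real b"
    proof -
      have "q + 1 = b\<^sup>2 * t + b + 1" by (simp add: q power2_eq_square algebra_simps)
      then have "real (s b (q + 1)) \<le> line b 1 (q + 1) - slope b 1 * real b"
        using below_line_1[of "q + 1"] unfolding below_line_def by metis
      then show ?thesis unfolding L1 gap by simp
    qed
    moreover have "1 - 2 / real b \<le> A * (real b - 2) * real q"
    proof -
      have "1 - 2 / real b = 1 / real b * (real b - 2) * 1" using B by (simp add: field_simps)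
      also have "\<dots> \<le> A * (real b - 2) * real q"
      proof (intro mult_mono)
        show "1 / real b \<le> A" using B by (simp add: A_def divide_simps power2_eq_square)
        have "q \<ge> 1" using q(1) b2 by simp
        then show "1 \<le> real q" by simp
      qed (use B A(2) in auto)
      finally show ?thesis .
    qed
    moreover have "line b 2 (b\<^sup>2 * q + b + 1) - slope b 2 * real b = 2 + A * real b * real q"
      unfolding gap L2 using B by (simp add: A_def field_simps power2_eq_square)
    ultimately show "real (s b (b\<^sup>2 * q + b + 1)) \<le>
        line b 2 (b\<^sup>2 * q + b + 1) - slope b 2 * real b"
      unfolding s_split_double_carry by (simp add: algebra_simps)
  }
qed simp

text \<open>In the critical classes the bounds add up exactly. Where \<open>q\<close> is dominated by a smaller \<open>q'\<close>,
  the bound for \<open>s q\<close> decreases by at least \<open>slope b j * (b + 1)\<close>, and this pays for using the weaker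
  bound at \<open>b q + 1\<close>, that is, for \<open>slope b (j + 1) * b\<close>.\<close>

lemma below_line_step:
  assumes j: "j \<ge> 1"
    and IH: "\<And>m. below_line b j m" "\<And>m. below_line b (j + 1) m"
  shows "below_line b (j + 2) m"
proof (rule below_line_induct_residues)
  fix q :: nat
  {
    fix q' assume q': "q' < q" "s b q \<le> s b q'"
    have "fib (j + 1) \<le> 2 * fib j"
      using j fib_mono[of "j - 1" j] by (cases j) auto
    then have "real (fib (j + 1)) \<le> real (fib j) * 2" by linarith
    also have "\<dots> \<le> real (fib j) * (real b + 1)" using b2 by (intro mult_left_mono) auto
    finally have "slope b (j + 1) * real b \<le> slope b j * (real b + 1)"
      using b2 by (simp add: slope_def divide_simps mult_right_mono del: fib.simps)
    also have "\<dots> \<le> line b j q - line b j q'"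
      unfolding line_diff using q'(1) mult_left_mono[of 1 "real q - real q'" "slope b j * (real b + 1)"]
      by (simp add: slope_nonneg)
    finally have "line b j q' \<le> line b j q - slope b (j + 1) * real b" by simp
    moreover have "real (s b q) \<le> line b j q'"
      using IH(1)[of q'] q'(2) unfolding below_line_def by linarith
    moreover have "real (s b (b * q + 1)) \<le> line b (j + 1) (b * q + 1)"
      using IH(2) by (simp add: below_line_def)
    ultimately show "real (s b (b\<^sup>2 * q + 1)) \<le> line b (j + 2) (b\<^sup>2 * q + 1)"
      unfolding line_split_carry s_split_carry of_nat_add by linarith
  }
  {
    fix r assume q: "q = b * r + 1"
    have "b * q + 1 = b\<^sup>2 * r + b + 1" by (simp add: q power2_eq_square algebra_simps)
    then have "real (s b (b * q + 1)) \<le> line b (j + 1) (b * q + 1) - slope b (j + 1) * real b"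
      using IH(2)[of "b * q + 1"] unfolding below_line_def by metis
    moreover have "real (s b q) \<le> line b j q" using IH(1) by (simp add: below_line_def)
    ultimately show "real (s b (b\<^sup>2 * q + 1)) \<le> line b (j + 2) (b\<^sup>2 * q + 1)"
      unfolding line_split_carry s_split_carry of_nat_add by linarith
  }
  {
    fix t assume q: "q = b * (b * t + 1)"
    have "q + 1 = b\<^sup>2 * t + b + 1" by (simp add: q power2_eq_square algebra_simps)
    then have "real (s b (q + 1)) \<le> line b j (q + 1) - slope b j * real b"
      using IH(1)[of "q + 1"] unfolding below_line_def by metis
    moreover have "real (s b (b * q + 1)) \<le> line b (j + 1) (b * q + 1)"
      using IH(2) by (simp add: below_line_def)
    ultimately show "real (s b (b\<^sup>2 * q + b + 1)) \<le>
        line b (j + 2) (b\<^sup>2 * q + b + 1) - slope b (j + 2) * real b"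
      unfolding line_split_double_carry s_split_double_carry of_nat_add by linarith
  }
qed (use j in simp)

lemma s_below_lines: "real (s b m) \<le> line b (Suc j) m"
proof -
  have "(\<forall>m. below_line b (Suc j) m) \<and> (\<forall>m. below_line b (Suc (Suc j)) m)"
  proof (induction j)
    case 0
    then show ?case using below_line_1 below_line_2 by (simp add: numeral_2_eq_2)
  next
    case (Suc j)
    then show ?case using below_line_step[of "Suc j"] by simp
  qed
  then show ?thesis by (simp add: below_line_def)
qed


lemma repunit_eq: "(real b - 1) * (\<Sum>i\<le>j. real b ^ i) = real b ^ (j + 1) - 1"
  using geometric_sum[of "real b" "Suc j"] b2 by (simp add: lessThan_Suc_atMost)

end

section \<open>From the lines to the power function\<close>

lemma phi_gt_1: "phi > 1" and phi_less_2: "phi < 2" and phi_square: "phi * phi = phi + 1"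
proof -
  have "sqrt 5 > 1" "sqrt 5 < 3" by (simp_all add: real_less_lsqrt)
  then show "phi > 1" "phi < 2" by (simp_all add: phi_def)
  show "phi * phi = phi + 1" by (simp add: phi_def field_simps)
qed

lemma fib_le_phi_power: "real (fib n) \<le> phi ^ n / sqrt 5 + 1"
proof -
  define psi :: real where "psi = (1 - sqrt 5) / 2"
  have "sqrt 5 \<ge> 1" "sqrt 5 \<le> 3" by (simp_all add: real_le_lsqrt)
  then have "\<bar>psi\<bar> \<le> 1" by (simp add: psi_def)
  then have "\<bar>psi ^ n\<bar> \<le> 1" by (simp add: power_abs power_le_one)
  then have "- (psi ^ n) \<le> 1 * sqrt 5" using \<open>sqrt 5 \<ge> 1\<close> by linarith
  then have "(- (psi ^ n)) / sqrt 5 \<le> 1" by (subst pos_divide_le_eq) auto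
  moreover have "real (fib n) = phi ^ n / sqrt 5 + (- (psi ^ n)) / sqrt 5"
    unfolding fib_closed_form by (simp add: phi_def psi_def diff_divide_distrib add.commute)
  ultimately show ?thesis by linarith
qed

text \<open>Concavity of \<open>t powr log b p\<close>, whose values at \<open>t = 1\<close> and \<open>t = b\<close> are \<open>1\<close> and \<open>p\<close>. It is obtained
  from the convexity of the inverse function, whose exponent \<open>1 / log b p\<close> is at least \<open>1\<close>.\<close>

lemma chord_below_powr:
  fixes b p t :: real
  assumes "1 < b" "1 < p" "p \<le> b" "1 \<le> t" "t \<le> b"
  shows "1 + (p - 1) * ((t - 1) / (b - 1)) \<le> t powr log b p"
proof -
  define l where "l = (t - 1) / (b - 1)"
  have l: "0 \<le> l" "l \<le> 1" using assms by (simp_all add: l_def)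
  have log_pos: "0 < log b p" "log b p \<le> 1" using assms by simp_all
  have pos: "1 + (p - 1) * l > 0" using l assms by (simp add: add_pos_nonneg)
  have "((1 - l) *\<^sub>R 1 + l *\<^sub>R p) powr (1 / log b p)
      \<le> (1 - l) * 1 powr (1 / log b p) + l * p powr (1 / log b p)"
    using assms l log_pos by (intro convex_onD[OF powr_convex]) auto
  also have "p powr (1 / log b p) = b"
  proof -
    have nz: "log b p \<noteq> 0" using log_pos(1) by linarith
    have "p powr (1 / log b p) = (b powr log b p) powr (1 / log b p)"
      using assms by simp
    also have "\<dots> = b" unfolding powr_powr times_divide_eq_right mult_1_right divide_self[OF nz]
      using assms(1) by simp
    finally show ?thesis .
  qed
  also have "(1 - l) * 1 powr (1 / log b p) + l * b = t"
  proof -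
    have "l * (b - 1) = t - 1" using assms by (simp add: l_def)
    then show ?thesis by (simp add: algebra_simps)
  qed
  finally have "(1 + (p - 1) * l) powr (1 / log b p) \<le> t" by (simp add: algebra_simps)
  then have "((1 + (p - 1) * l) powr (1 / log b p)) powr log b p \<le> t powr log b p"
    using log_pos by (intro powr_mono2) auto
  then show ?thesis using log_pos pos by (simp add: powr_powr l_def)
qed

lemma power_powr: "(x ^ n) powr a = (x powr a) ^ n" if "x > 0" for x a :: real
  using that by (simp add: powr_realpow[symmetric] powr_powr mult.commute)

lemma s_le_powr:
  assumes b: "b \<ge> 2" and m: "m \<ge> 1"
  shows "real (s b m) \<le>
    (real b ^ 2 - 1) powr log (real b) phi / sqrt 5 * real m powr log (real b) phi + 3"
proof -
  define B where "B = real b"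
  define \<alpha> where "\<alpha> = log B phi"
  have B: "B \<ge> 2" using b by (simp add: B_def)
  have sq: "b < b\<^sup>2" using b by (simp add: power2_eq_square)
  have le: "b * 1 \<le> (b\<^sup>2 - 1) * m" using sq m by (intro mult_le_mono) auto
  \<comment> \<open>The scale of \<open>m\<close>: the segment whose end points are near \<open>b ^ n / (b\<^sup>2 - 1)\<close> and
    \<open>b ^ (n + 1) / (b\<^sup>2 - 1)\<close>.\<close>
  obtain n where n: "b ^ n \<le> (b\<^sup>2 - 1) * m" "(b\<^sup>2 - 1) * m < b ^ (n + 1)"
    using ex_power_ivl1[OF b, of "(b\<^sup>2 - 1) * m"] le b by (auto simp del: One_nat_def)
  have "n \<noteq> 0"
  proof
    assume "n = 0"
    then have "(b\<^sup>2 - 1) * m < b" using n(2) by simp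
    then show False using le by simp
  qed
  then obtain j where j: "n = Suc j" using not0_implies_Suc by blast
  have cast: "real ((b\<^sup>2 - 1) * m) = (B ^ 2 - 1) * real m"
    using sq by (simp add: B_def of_nat_diff)
  define t where "t = (B ^ 2 - 1) * real m / B ^ (j + 1)"
  have t: "1 \<le> t" "t \<le> B"
  proof -
    have "real (b ^ n) \<le> real ((b\<^sup>2 - 1) * m)" "real ((b\<^sup>2 - 1) * m) \<le> real (b ^ (n + 1))"
      using n by (simp_all only: of_nat_le_iff)
    then show "1 \<le> t" "t \<le> B" unfolding cast using B
      by (simp_all add: t_def j B_def divide_simps)
  qed
  define l where "l = (t - 1) / (B - 1)"
  have l: "0 \<le> l" "l \<le> 1" using t B by (simp_all add: l_def)
  have phi_pow: "phi ^ j = phi ^ (j + 1) * (phi - 1)"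
  proof -
    have "phi * (phi - 1) = 1" using phi_square by (simp add: algebra_simps)
    then show ?thesis by simp
  qed
  have fib_small: "real (fib j) / B ^ (j + 1) \<le> 1"
  proof -
    have "fib j \<le> fib (j + 2)" by (rule fib_mono) simp
    also have "\<dots> \<le> 2 ^ j" by (rule fib_le_two_power)
    finally have "real (fib j) \<le> 2 ^ j" by (metis of_nat_le_iff of_nat_numeral of_nat_power)
    also have "\<dots> \<le> B ^ j" using B by (intro power_mono) auto
    also have "\<dots> \<le> B ^ (j + 1)" using B by (intro power_increasing) auto
    finally show ?thesis using B by (simp add: divide_le_eq)
  qed
  have "B ^ (j + 1) \<noteq> 0" using B by simp
  then have t_mult: "t * B ^ (j + 1) = (B ^ 2 - 1) * real m"
    using nonzero_eq_divide_eq t_def by blast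
  then have cast_t: "(B + 1) * real m * (B - 1) = t * B ^ (j + 1)"
    by (simp add: algebra_simps power2_eq_square del: power_Suc)
  have excess: "((B + 1) * real m - (\<Sum>i\<le>j. B ^ i)) / B ^ (j + 1) = l + 1 / (B ^ (j + 1) * (B - 1))"
  proof -
    have "((B + 1) * real m - (\<Sum>i\<le>j. B ^ i)) * (B - 1) = (t - 1) * B ^ (j + 1) + 1"
      using cast_t repunit_eq[OF b, of j] by (simp add: B_def algebra_simps)
    then have "(B + 1) * real m - (\<Sum>i\<le>j. B ^ i) = ((t - 1) * B ^ (j + 1) + 1) / (B - 1)"
      using B by (simp add: eq_divide_eq)
    then show ?thesis
      using B by (simp add: l_def add_divide_distrib)
  qed
  have "line b j m = real (fib (j + 1)) +
      real (fib j) * (((B + 1) * real m - (\<Sum>i\<le>j. B ^ i)) / B ^ (j + 1))"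
    by (simp add: line_def slope_def B_def del: fib.simps)
  also have "\<dots> = real (fib (j + 1)) + real (fib j) * l + (real (fib j) / B ^ (j + 1)) * (1 / (B - 1))"
    unfolding excess by (simp add: algebra_simps del: fib.simps)
  also have "\<dots> \<le> real (fib (j + 1)) + real (fib j) * l + 1 * 1"
    using fib_small B by (intro add_left_mono mult_mono) auto
  also have "\<dots> \<le> (phi ^ (j + 1) / sqrt 5 + 1) + (phi ^ j / sqrt 5 + 1) * l + 1 * 1"
    using l by (intro add_mono mult_right_mono fib_le_phi_power) auto
  also have "phi ^ j / sqrt 5 = phi ^ (j + 1) / sqrt 5 * (phi - 1)"
    unfolding phi_pow by simp
  also have "(phi ^ (j + 1) / sqrt 5 + 1) + (phi ^ (j + 1) / sqrt 5 * (phi - 1) + 1) * l + 1 * 1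
      \<le> phi ^ (j + 1) / sqrt 5 * (1 + (phi - 1) * l) + 3"
    using l by (simp add: ring_distribs del: power_Suc)
  also have "\<dots> \<le> phi ^ (j + 1) / sqrt 5 * t powr \<alpha> + 3"
    using chord_below_powr[of B phi t] B t phi_gt_1 phi_less_2
    by (intro add_right_mono mult_left_mono) (simp_all add: l_def \<alpha>_def)
  also have "phi ^ (j + 1) * t powr \<alpha> = ((B ^ 2 - 1) * real m) powr \<alpha>"
  proof -
    have "B ^ (j + 1) * t = (B ^ 2 - 1) * real m"
      using t_mult by (simp add: mult.commute)
    then have "((B ^ 2 - 1) * real m) powr \<alpha> = (B ^ (j + 1)) powr \<alpha> * t powr \<alpha>"
      using B t by (subst \<open>B ^ (j + 1) * t = _\<close>[symmetric], subst powr_mult) simp_all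
    also have "(B ^ (j + 1)) powr \<alpha> = (B powr \<alpha>) ^ (j + 1)"
      using B by (intro power_powr) simp
    also have "B powr \<alpha> = phi" using B phi_gt_1 by (simp add: \<alpha>_def)
    finally show ?thesis by simp
  qed
  then have "phi ^ (j + 1) / sqrt 5 * t powr \<alpha> + 3 =
      (B ^ 2 - 1) powr \<alpha> / sqrt 5 * real m powr \<alpha> + 3"
    by (simp only: times_divide_eq_left powr_mult)
  finally have "line b j m \<le> (B ^ 2 - 1) powr \<alpha> / sqrt 5 * real m powr \<alpha> + 3" .
  moreover have "real (s b m) \<le> line b j m"
  proof (cases j)
    case 0
    \<comment> \<open>The line with index \<open>0\<close> is the constant \<open>1\<close>, but \<open>m = 1\<close> is the only argument on this scale.\<close>
    have "m = 1"
    proof (rule ccontr)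
      assume "m \<noteq> 1"
      then have "(b\<^sup>2 - 1) * 2 \<le> (b\<^sup>2 - 1) * m" using m by (intro mult_le_mono2) simp
      moreover have "(b\<^sup>2 - 1) * m < b\<^sup>2" using n(2) by (simp add: j 0 power2_eq_square)
      moreover have "b\<^sup>2 > 2" using sq b by linarith
      ultimately show False by linarith
    qed
    then show ?thesis using s_1[OF b] by (simp add: 0 line_def slope_def)
  next
    case (Suc i)
    then show ?thesis using s_below_lines[OF b] by simp
  qed
  ultimately show ?thesis by (simp add: B_def \<alpha>_def)
qed

section \<open>The lower bound and the limit superior\<close>

definition peak :: "nat \<Rightarrow> nat \<Rightarrow> nat" where
  "peak b j = (\<Sum>i\<le>j. (b\<^sup>2) ^ i)"

lemma peak_Suc: "peak b (Suc j) = b\<^sup>2 * peak b j + 1"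
  by (simp add: peak_def sum.atMost_Suc_shift sum_distrib_left del: sum.atMost_Suc)

text \<open>The pair of values at consecutive arguments is what the recurrence propagates.\<close>

lemma s_peak:
  assumes "b \<ge> 2"
  shows "s b (peak b j) = fib (2 * j + 2) \<and> s b (peak b j + 1) = fib (2 * j + 1)"
proof (induction j)
  case 0
  show ?case
    using s_1[OF assms] s_forced_digit[OF assms, of 2 0] assms by (simp add: peak_def)
next
  case (Suc j)
  have "s b (peak b (Suc j) + 1) = s b (peak b j) + s b (peak b j + 1)"
    using s_forced_digit[OF assms, of 2 "b * peak b j"] s_carry[OF assms, of "peak b j"] assms
    by (simp add: peak_Suc power2_eq_square mult.assoc)
  moreover have "s b (peak b (Suc j)) = 2 * s b (peak b j) + s b (peak b j + 1)"
    unfolding peak_Suc s_split_carry[OF assms] using s_carry[OF assms, of "peak b j"] by simp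
  ultimately show ?case using Suc by simp
qed

lemma strict_mono_peak: "b \<ge> 2 \<Longrightarrow> strict_mono (peak b)"
  by (simp add: strict_mono_Suc_iff peak_def)

lemma peak_le:
  assumes "b \<ge> 2"
  shows "(real b ^ 2 - 1) * real (peak b j) \<le> real b ^ (2 * j + 2)"
proof -
  have "b\<^sup>2 \<ge> 2" using assms by (simp add: power2_eq_square) (meson dual_order.trans le_square)
  from repunit_eq[OF this, of j]
  have "(real b ^ 2 - 1) * real (peak b j) = (real b ^ 2) ^ (j + 1) - 1"
    by (simp add: peak_def)
  also have "(real b ^ 2) ^ (j + 1) = real b ^ (2 * j + 2)"
    unfolding power_mult[symmetric] by simp
  finally show ?thesis by simp
qed

text \<open>By \<open>peak_le\<close> the peaks lie to the left of the points \<open>b ^ k / (b\<^sup>2 - 1)\<close> with \<open>k = 2 * j + 2\<close>, at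
  which the power function is a constant multiple of \<open>phi ^ k\<close>. The remaining factor on the left
  tends to \<open>1\<close>.\<close>

lemma s_peak_ge:
  assumes "b \<ge> 2"
  shows "(real b ^ 2 - 1) powr log (real b) phi / sqrt 5 *
      (real (fib (2 * j + 2)) / (phi ^ (2 * j + 2) / sqrt 5))
    \<le> real (s b (peak b j)) / real (peak b j) powr log (real b) phi"
proof -
  define B where "B = real b"
  define \<alpha> where "\<alpha> = log B phi"
  have B: "B \<ge> 2" using assms by (simp add: B_def)
  have "\<alpha> > 0" using B phi_gt_1 by (simp add: \<alpha>_def)
  have "4 \<le> B ^ 2" using power_mono[of 2 B 2] B by simp
  have "peak b j > 0" by (cases j) (simp_all add: peak_Suc, simp add: peak_def)
  have "B powr \<alpha> = phi" using B phi_gt_1 by (simp add: \<alpha>_def)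
  have "(B ^ 2 - 1) powr \<alpha> * real (peak b j) powr \<alpha> = ((B ^ 2 - 1) * real (peak b j)) powr \<alpha>"
    using \<open>4 \<le> B ^ 2\<close> by (simp add: powr_mult)
  also have "\<dots> \<le> (B ^ (2 * j + 2)) powr \<alpha>"
    using peak_le[OF assms, of j] \<open>\<alpha> > 0\<close> \<open>4 \<le> B ^ 2\<close>
    by (intro powr_mono2) (simp_all add: B_def)
  also have "\<dots> = (B powr \<alpha>) ^ (2 * j + 2)"
    using B by (intro power_powr) simp
  finally have "(B ^ 2 - 1) powr \<alpha> * real (peak b j) powr \<alpha> \<le> phi ^ (2 * j + 2)"
    unfolding \<open>B powr \<alpha> = phi\<close> .
  then have "(B ^ 2 - 1) powr \<alpha> / phi ^ (2 * j + 2) \<le> 1 / real (peak b j) powr \<alpha>"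
    using phi_gt_1 \<open>peak b j > 0\<close> by (simp add: divide_simps mult.commute del: power_Suc)
  then have "real (fib (2 * j + 2)) * ((B ^ 2 - 1) powr \<alpha> / phi ^ (2 * j + 2))
      \<le> real (fib (2 * j + 2)) * (1 / real (peak b j) powr \<alpha>)"
    by (intro mult_left_mono) auto
  then show ?thesis
    using s_peak[OF assms, of j] by (simp add: B_def \<alpha>_def mult_ac del: power_Suc fib.simps)
qed

theorem theorem1:
  fixes b :: nat
  assumes "b \<ge> 2"
  shows "limsup (\<lambda>m. ereal (real (s b m) / real m powr log (real b) phi)) =
         ereal (phi powr log (real b) (real b ^ 2 - 1) / sqrt 5)"
proof -
  define \<alpha> where "\<alpha> = log (real b) phi"
  define C where "C = (real b ^ 2 - 1) powr \<alpha> / sqrt 5"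
  define f where "f m = real (s b m) / real m powr \<alpha>" for m
  have "\<alpha> > 0" using assms phi_gt_1 by (simp add: \<alpha>_def)
  have "real b ^ 2 - 1 > 0" using assms power_mono[of 2 "real b" 2] by simp
  then have C_eq: "phi powr log (real b) (real b ^ 2 - 1) / sqrt 5 = C"
    using phi_gt_1 by (simp add: C_def \<alpha>_def powr_def log_def mult.commute)
  have "limsup (\<lambda>m. ereal (f m)) = ereal C"
  proof (rule antisym)
    have "(\<lambda>m. C + 3 * real m powr - \<alpha>) \<longlonglongrightarrow> C + 3 * 0"
      using \<open>\<alpha> > 0\<close> by (intro tendsto_intros tendsto_neg_powr filterlim_real_sequentially) auto
    then have "limsup (\<lambda>m. ereal (C + 3 * real m powr - \<alpha>)) = ereal C"
      by (intro lim_imp_Limsup) auto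
    moreover have "\<forall>\<^sub>F m in sequentially. ereal (f m) \<le> ereal (C + 3 * real m powr - \<alpha>)"
    proof (rule eventually_mono[OF eventually_ge_at_top[of 1]])
      fix m :: nat assume m: "m \<ge> 1"
      then have "f m \<le> (C * real m powr \<alpha> + 3) / real m powr \<alpha>"
        using s_le_powr[OF assms m] by (simp add: f_def C_def \<alpha>_def divide_right_mono)
      also have "\<dots> = C + 3 * real m powr - \<alpha>"
        using m by (simp add: powr_minus field_simps)
      finally show "ereal (f m) \<le> ereal (C + 3 * real m powr - \<alpha>)" by simp
    qed
    ultimately show "limsup (\<lambda>m. ereal (f m)) \<le> ereal C"
      using Limsup_mono by metis
  next
    define g where "g n = C * (real (fib n) / (phi ^ n / sqrt 5))" for n
    have "g \<longlonglongrightarrow> C * 1"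
      unfolding g_def using fib_asymptotics
      by (intro tendsto_mult tendsto_const) (simp add: phi_def add.commute)
    moreover have "strict_mono (\<lambda>j. 2 * j + 2 :: nat)" by (simp add: strict_mono_Suc_iff)
    ultimately have "(\<lambda>j. g (2 * j + 2)) \<longlonglongrightarrow> C"
      using LIMSEQ_subseq_LIMSEQ[of g C "\<lambda>j. 2 * j + 2"] by (simp add: o_def)
    then have "limsup (\<lambda>j. ereal (g (2 * j + 2))) = ereal C"
      by (intro lim_imp_Limsup) auto
    moreover have "limsup (\<lambda>j. ereal (g (2 * j + 2))) \<le> limsup (\<lambda>j. ereal (f (peak b j)))"
      using s_peak_ge[OF assms]
      by (intro Limsup_mono always_eventually) (simp add: f_def g_def C_def \<alpha>_def)
    moreover have "limsup (\<lambda>j. ereal (f (peak b j))) \<le> limsup (\<lambda>m. ereal (f m))"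
      using limsup_subseq_mono[OF strict_mono_peak[OF assms], of "\<lambda>m. ereal (f m)"]
      by (simp add: o_def)
    ultimately show "ereal C \<le> limsup (\<lambda>m. ereal (f m))" by simp
  qed
  then show ?thesis by (simp only: C_eq f_def \<alpha>_def)
qed

end
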